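(* Let $n_Q\ge1$ be an integer, $v$ a parameter, $g_Q$ a function as in the context, and $z_i,z_j$ nonzero parameters. For all decorated spins $\alpha,\beta,\gamma,\delta\in D$, with the weights $R$ of the context, $$\sum_{p,q\in D}R_{z_i,z_j}(\beta,\alpha;p,q)\,R_{z_j,z_i}(p,q;\delta,\gamma)=\begin{cases}1&\text{if }\alpha=\gamma\text{ and }\beta=\delta,\\0&\text{otherwise.}\end{cases}$$ (The left side is the partition function of the system of two consecutive $R$-vertices, $R_{z_i,z_j}$ followed on the right by $R_{z_j,z_i}$, with boundary labels $\alpha$ bottom-left, $\beta$ top-left, $\gamma$ bottom-right, $\delta$ top-right.)
   Context: Decorated spins: $D=\{-0,+1,+2,\dots,+n_Q\}$; decorations are integers mod $n_Q$ (so $+0$ means $+n_Q$), compared using representatives in $\{1,\dots,n_Q\}$. $g_Q:\mathbb Z\to\mathbb C$ is any function periodic mod $n_Q$ with $g_Q(0)=-v$ and $g_Q(t)g_Q(n_Q-t)=v$ for $t\not\equiv0\pmod{n_Q}$. $R$-vertex weights $R_{z_i,z_j}(p,s;t,u)$, with $p$ = top-left, $s$ = bottom-left, $t$ = top-right, $u$ = bottom-right edge (the $z_i$ strand runs from top-left to bottom-right, the $z_j$ strand from bottom-left to top-right). Put $x=(z_i/z_j)^{n_Q}$ (parameters are assumed such that all denominators are nonzero); for $a,b\in\{1,\dots,n_Q\}$, $a\ne b$: $R(+a,+a;+a,+a)=\frac{-v+x}{1-vx}$; $R(+a,+b;+b,+a)=g_Q(a-b)\frac{1-x}{1-vx}$;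 $R(+a,+b;+a,+b)=\frac{1-v}{1-vx}\cdot x$ if $a>b$, and $\frac{1-v}{1-vx}$ if $a<b$; $R(-0,-0;-0,-0)=1$; $R(-0,+a;+a,-0)=\frac{v(1-x)}{1-vx}$; $R(+a,-0;-0,+a)=\frac{1-x}{1-vx}$; $R(+a,-0;+a,-0)=\frac{(1-v)x}{1-vx}$; $R(-0,+a;-0,+a)=\frac{1-v}{1-vx}$; all other values are $0$. $R_{z_j,z_i}$ is given by the same formulas with $x$ replaced by $x^{-1}=(z_j/z_i)^{n_Q}$. *)

theory Defs
  imports Complex_Main
begin

text \<open>
  A decorated spin is \<open>-0\<close>, written \<open>Minus0\<close>, or \<open>+a\<close>, written \<open>Plus a\<close>.  The decoration
  \<open>a\<close>, an integer modulo \<open>n\<close>, is stored as its representative in \<open>{1..n}\<close>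
  (so \<open>+0\<close> is \<open>Plus n\<close>), since the weights compare these representatives.
\<close>

datatype spin = Minus0 | Plus int

definition spins :: "nat \<Rightarrow> spin set" where
  "spins n = insert Minus0 (Plus ` {1..int n})"

definition admissible_g :: "nat \<Rightarrow> complex \<Rightarrow> (int \<Rightarrow> complex) \<Rightarrow> bool" where
  "admissible_g n v g \<longleftrightarrow>
     (\<forall>t. g (t + int n) = g t) \<and>
     g 0 = - v \<and>
     (\<forall>t. \<not> int n dvd t \<longrightarrow> g t * g (int n - t) = v)"

text \<open>
  The four spin arguments are, in this order, the labels of the top-left, bottom-left,
  top-right and bottom-right edges.  The values are only meaningful on \<open>spins n\<close>.
\<close>

fun R_weight_x :: "complex \<Rightarrow> (int \<Rightarrow> complex) \<Rightarrow> complex \<Rightarrow>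
    spin \<Rightarrow> spin \<Rightarrow> spin \<Rightarrow> spin \<Rightarrow> complex" where
  "R_weight_x v g x (Plus a) (Plus b) (Plus c) (Plus d) =
     (if a = b \<and> c = a \<and> d = a then (- v + x) / (1 - v * x)
      else if a \<noteq> b \<and> c = b \<and> d = a then g (a - b) * ((1 - x) / (1 - v * x))
      else if a > b \<and> c = a \<and> d = b then (1 - v) / (1 - v * x) * x
      else if a < b \<and> c = a \<and> d = b then (1 - v) / (1 - v * x)
      else 0)"
| "R_weight_x v g x Minus0 Minus0 Minus0 Minus0 = 1"
| "R_weight_x v g x Minus0 (Plus a) (Plus b) Minus0 =
     (if a = b then v * (1 - x) / (1 - v * x) else 0)"
| "R_weight_x v g x (Plus a) Minus0 Minus0 (Plus b) =
     (if a = b then (1 - x) / (1 - v * x) else 0)"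
| "R_weight_x v g x (Plus a) Minus0 (Plus b) Minus0 =
     (if a = b then (1 - v) * x / (1 - v * x) else 0)"
| "R_weight_x v g x Minus0 (Plus a) Minus0 (Plus b) =
     (if a = b then (1 - v) / (1 - v * x) else 0)"
| "R_weight_x v g x _ _ _ _ = 0"

definition R_weight :: "nat \<Rightarrow> complex \<Rightarrow> (int \<Rightarrow> complex) \<Rightarrow> complex \<Rightarrow> complex \<Rightarrow>
    spin \<Rightarrow> spin \<Rightarrow> spin \<Rightarrow> spin \<Rightarrow> complex" where
  "R_weight n v g zi zj = R_weight_x v g ((zi / zj) ^ n)"

end

theory Submission
  imports Defs
begin

text \<open>
  The composite of the two vertices is a product of matrices indexed by pairs of spins, and the
  claim is that it is the identity.  A vertex only permutes the two spins entering it, so this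
  matrix is block diagonal: the blocks are \<open>1 \<times> 1\<close> (two equal spins) or \<open>2 \<times> 2\<close>
  (an unordered pair of distinct spins).

  All \<open>2 \<times> 2\<close> blocks have one shape once \<open>-0\<close> is ordered below
  every \<open>+a\<close>.  For distinct spins, the weight for going straight on is \<open>(1 - v) / (1 - v x)\<close>,
  with an extra factor \<open>x\<close> exactly when the larger spin is on top; the weight for exchanging the
  spins is \<open>h (1 - x) / (1 - v x)\<close>, where the two coefficients \<open>h\<close> of a block have product
  \<open>v\<close>: they are \<open>v\<close> and \<open>1\<close> if \<open>-0\<close> is involved, and \<open>g (a - b)\<close> and \<open>g (b - a)\<close> otherwise.
  With \<open>y = 1 / x\<close>, a diagonal entry of the product of two blocks is \<open>1\<close> because
  \<open>v (1 - x) (1 - y) + (1 - v)\<^sup>2 = (1 - v x) (1 - v y)\<close>,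
  and an off-diagonal entry is a multiple of \<open>(1 - x) + x (1 - y) = 0\<close> or of
  \<open>(1 - x) y + (1 - y) = 0\<close>.  The \<open>1 \<times> 1\<close> block of \<open>+a\<close>
  is \<open>1\<close> because \<open>(x - v) (y - v) = (1 - v x) (1 - v y)\<close>, and that of \<open>-0\<close> is \<open>1 * 1\<close>.
\<close>

section \<open>A uniform description of the weights\<close>

fun spin_less :: "spin \<Rightarrow> spin \<Rightarrow> bool" where
  "spin_less (Plus a) (Plus b) = (a < b)"
| "spin_less Minus0 (Plus b) = True"
| "spin_less _ Minus0 = False"

lemma spin_less_asym: "\<beta> \<noteq> \<alpha> \<Longrightarrow> spin_less \<alpha> \<beta> \<longleftrightarrow> \<not> spin_less \<beta> \<alpha>"
  by (cases \<alpha>; cases \<beta>) auto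

fun exchange_coeff :: "complex \<Rightarrow> (int \<Rightarrow> complex) \<Rightarrow> spin \<Rightarrow> spin \<Rightarrow> complex" where
  "exchange_coeff v g (Plus a) (Plus b) = g (a - b)"
| "exchange_coeff v g Minus0 (Plus b) = v"
| "exchange_coeff v g _ Minus0 = 1"

lemma R_weight_x_straight:
  assumes "\<beta> \<noteq> \<alpha>"
  shows "R_weight_x v g x \<beta> \<alpha> \<beta> \<alpha> =
    (1 - v) * (if spin_less \<alpha> \<beta> then x else 1) / (1 - v * x)"
  using assms by (cases \<alpha>; cases \<beta>) auto

lemma R_weight_x_exchange:
  assumes "\<beta> \<noteq> \<alpha>"
  shows "R_weight_x v g x \<beta> \<alpha> \<alpha> \<beta> = exchange_coeff v g \<beta> \<alpha> * (1 - x) / (1 - v * x)"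
  using assms by (cases \<alpha>; cases \<beta>) auto

lemma R_weight_x_eq_0:
  assumes "(p, q) \<noteq> (\<beta>, \<alpha>)" and "(p, q) \<noteq> (\<alpha>, \<beta>)"
  shows "R_weight_x v g x \<beta> \<alpha> p q = 0"
  using assms by (cases \<alpha>; cases \<beta>; cases p; cases q) auto

text \<open>
  Distinct representatives in \<open>{1..n}\<close> are incongruent modulo \<open>n\<close>, and \<open>n - (a - b)\<close> is
  congruent to \<open>b - a\<close>; so the relation \<open>g t * g (n - t) = v\<close> applies to \<open>t = a - b\<close>.
\<close>

lemma admissible_g_opposite:
  assumes g: "admissible_g n v g" and ab: "a \<in> {1..int n}" "b \<in> {1..int n}" "a \<noteq> b"
  shows "g (a - b) * g (b - a) = v"
proof -
  have "\<not> int n dvd a - b"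
    using ab zdvd_imp_le[of "int n" "a - b"] zdvd_imp_le[of "int n" "b - a"]
    by (cases "a > b") (auto simp: dvd_diff_commute)
  then have "g (a - b) * g (int n - (a - b)) = v"
    using g by (auto simp: admissible_g_def)
  moreover have "g (int n - (a - b)) = g (b - a)"
    using g by (metis admissible_g_def add.commute diff_diff_eq2 add_diff_eq)
  ultimately show ?thesis by simp
qed

lemma exchange_coeff_opposite:
  assumes "admissible_g n v g" and "\<alpha> \<in> spins n" "\<beta> \<in> spins n" "\<beta> \<noteq> \<alpha>"
  shows "exchange_coeff v g \<beta> \<alpha> * exchange_coeff v g \<alpha> \<beta> = v"
  using assms admissible_g_opposite[OF assms(1)]
  by (cases \<alpha>; cases \<beta>) (auto simp: spins_def)

section \<open>Inverting the blocks\<close>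

lemma denominator_product:
  fixes v x y :: complex
  assumes "x * y = 1"
  shows "(1 - v * x) * (1 - v * y) = v * ((1 - x) * (1 - y)) + (1 - v) * (1 - v)"
    and "(1 - v * x) * (1 - v * y) = (x - v) * (y - v)"
  using assms by algebra+

lemma R_weight_x_diagonal_inverse:
  assumes "x * y = 1" and "1 - v * x \<noteq> 0" and "1 - v * y \<noteq> 0"
  shows "R_weight_x v g x \<beta> \<beta> \<beta> \<beta> * R_weight_x v g y \<beta> \<beta> \<beta> \<beta> = 1"
  using assms denominator_product(2)[OF assms(1), of v] by (cases \<beta>) auto

lemma R_weight_x_block_diagonal_entry:
  assumes xy: "x * y = 1" and nz: "1 - v * x \<noteq> 0" "1 - v * y \<noteq> 0"
    and "\<beta> \<noteq> \<alpha>" and h: "exchange_coeff v g \<beta> \<alpha> * exchange_coeff v g \<alpha> \<beta> = v"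
  shows "R_weight_x v g x \<beta> \<alpha> \<beta> \<alpha> * R_weight_x v g y \<beta> \<alpha> \<beta> \<alpha>
       + R_weight_x v g x \<beta> \<alpha> \<alpha> \<beta> * R_weight_x v g y \<alpha> \<beta> \<beta> \<alpha> = 1"
    (is "?S + ?E = 1")
proof -
  have "?S = (1 - v) * (1 - v) / ((1 - v * x) * (1 - v * y))"
    using xy \<open>\<beta> \<noteq> \<alpha>\<close> by (simp add: R_weight_x_straight ac_simps)
  moreover have "?E = (exchange_coeff v g \<beta> \<alpha> * exchange_coeff v g \<alpha> \<beta>) * ((1 - x) * (1 - y))
      / ((1 - v * x) * (1 - v * y))"
    using \<open>\<beta> \<noteq> \<alpha>\<close> by (simp add: R_weight_x_exchange ac_simps)
  ultimately have "?S + ?E =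
      (v * ((1 - x) * (1 - y)) + (1 - v) * (1 - v)) / ((1 - v * x) * (1 - v * y))"
    by (simp only: h add_divide_distrib add.commute)
  then show ?thesis
    using nz by (simp flip: denominator_product(1)[OF xy])
qed

lemma R_weight_x_block_off_diagonal_entry:
  assumes xy: "x * y = 1" and "\<beta> \<noteq> \<alpha>"
  shows "R_weight_x v g x \<beta> \<alpha> \<beta> \<alpha> * R_weight_x v g y \<beta> \<alpha> \<alpha> \<beta>
       + R_weight_x v g x \<beta> \<alpha> \<alpha> \<beta> * R_weight_x v g y \<alpha> \<beta> \<alpha> \<beta> = 0"
    (is "?SE + ?ES = 0")
proof -
  define s where "s = (if spin_less \<alpha> \<beta> then x else 1)"
  define t where "t = (if spin_less \<beta> \<alpha> then y else 1)"
  define k where "k = (1 - v) * exchange_coeff v g \<beta> \<alpha> / ((1 - v * x) * (1 - v * y))"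
  have "?SE = k * (s * (1 - y))" and "?ES = k * ((1 - x) * t)"
    using \<open>\<beta> \<noteq> \<alpha>\<close> by (simp_all add: R_weight_x_straight R_weight_x_exchange
        k_def s_def t_def ac_simps)
  then have "?SE + ?ES = k * (s * (1 - y) + (1 - x) * t)"
    by (simp add: distrib_left)
  \<comment> \<open>Exactly one of the two orders of the pair has the larger spin on top, so exactly one of
    the factors \<open>s = x\<close> and \<open>t = y\<close> is present.\<close>
  moreover have "s * (1 - y) + (1 - x) * t = 0"
    using xy spin_less_asym[OF \<open>\<beta> \<noteq> \<alpha>\<close>] by (auto simp: s_def t_def algebra_simps)
  ultimately show ?thesis by simp
qed

section \<open>Reduction of the partition function to a block\<close>

lemma finite_spins: "finite (spins n)"
  by (simp add: spins_def)

lemma sum_R_weight_x: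
  assumes "\<alpha> \<in> spins n" and "\<beta> \<in> spins n"
  shows "(\<Sum>p\<in>spins n. \<Sum>q\<in>spins n. R_weight_x v g x \<beta> \<alpha> p q * f p q) =
    (if \<beta> = \<alpha> then R_weight_x v g x \<beta> \<beta> \<beta> \<beta> * f \<beta> \<beta>
     else R_weight_x v g x \<beta> \<alpha> \<beta> \<alpha> * f \<beta> \<alpha> + R_weight_x v g x \<beta> \<alpha> \<alpha> \<beta> * f \<alpha> \<beta>)"
    (is "?lhs = ?rhs")
proof -
  have "?lhs = (\<Sum>(p, q)\<in>spins n \<times> spins n. R_weight_x v g x \<beta> \<alpha> p q * f p q)"
    by (rule sum.cartesian_product)
  also have "\<dots> = (\<Sum>(p, q)\<in>{(\<beta>, \<alpha>), (\<alpha>, \<beta>)}. R_weight_x v g x \<beta> \<alpha> p q * f p q)"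
    using assms by (intro sum.mono_neutral_right)
      (auto simp: finite_spins, (metis R_weight_x_eq_0 prod.inject)+)
  also have "\<dots> = ?rhs"
    by simp
  finally show ?thesis .
qed

theorem R_weight_x_unitarity:
  assumes "admissible_g n v g" and xy: "x * y = 1"
    and nz: "1 - v * x \<noteq> 0" "1 - v * y \<noteq> 0"
    and spins: "\<alpha> \<in> spins n" "\<beta> \<in> spins n"
  shows "(\<Sum>p\<in>spins n. \<Sum>q\<in>spins n. R_weight_x v g x \<beta> \<alpha> p q * R_weight_x v g y p q \<delta> \<gamma>) =
         (if \<alpha> = \<gamma> \<and> \<beta> = \<delta> then 1 else 0)"
    (is "?Z = _")
proof -
  consider "(\<delta>, \<gamma>) = (\<beta>, \<alpha>)" | "(\<delta>, \<gamma>) = (\<alpha>, \<beta>)" "\<beta> \<noteq> \<alpha>"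
    | "(\<delta>, \<gamma>) \<noteq> (\<beta>, \<alpha>)" "(\<delta>, \<gamma>) \<noteq> (\<alpha>, \<beta>)"
    by blast
  then show ?thesis
  proof cases
    case 1
    then have "?Z = 1"
      using R_weight_x_diagonal_inverse[OF xy nz]
        R_weight_x_block_diagonal_entry[OF xy nz _ exchange_coeff_opposite[OF assms(1) spins]]
      by (simp add: sum_R_weight_x[OF spins])
    with 1 show ?thesis by simp
  next
    case 2
    then have "?Z = 0"
      using R_weight_x_block_off_diagonal_entry[OF xy] by (simp add: sum_R_weight_x[OF spins])
    with 2 show ?thesis by simp
  next
    case 3
    then have "?Z = 0"
      by (simp add: sum_R_weight_x[OF spins] R_weight_x_eq_0)
    with 3 show ?thesis by auto
  qed
qed

theorem theorem5p8:
  fixes n :: nat and v zi zj :: complex and g :: "int \<Rightarrow> complex"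
    and \<alpha> \<beta> \<gamma> \<delta> :: spin
  assumes "n \<ge> 1"
    and "admissible_g n v g"
    and "zi \<noteq> 0" and "zj \<noteq> 0"
    and "1 - v * (zi / zj) ^ n \<noteq> 0" and "1 - v * (zj / zi) ^ n \<noteq> 0"
    and "\<alpha> \<in> spins n" and "\<beta> \<in> spins n" and "\<gamma> \<in> spins n" and "\<delta> \<in> spins n"
  shows "(\<Sum>p\<in>spins n. \<Sum>q\<in>spins n.
            R_weight n v g zi zj \<beta> \<alpha> p q * R_weight n v g zj zi p q \<delta> \<gamma>) =
         (if \<alpha> = \<gamma> \<and> \<beta> = \<delta> then 1 else 0)"
proof -
  have "(zi / zj) ^ n * (zj / zi) ^ n = 1"
    using assms(3,4) by (simp flip: power_mult_distrib)
  then show ?thesis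
    unfolding R_weight_def using assms by (intro R_weight_x_unitarity)
qed

end
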